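(* Let $n, m, N \ge 1$ be integers, let $\bar P \in \mathbb{R}^{n\times n}$ be a (prior) covariance matrix, let $H \in \mathbb{R}^{m\times n}$ be the matrix of a linear measurement of the state $\mathbf{x}\in\mathbb{R}^n$ (measurement function $\mathbf{x}\mapsto H\mathbf{x}$), and let $R \in \mathbb{R}^{m\times m}$ be the symmetric positive definite measurement noise covariance matrix. Define $P^{(0)} = \bar P$ and, for $1 \le i \le N$, $$K^{(i)} = P^{(i-1)}H^T\left(H P^{(i-1)}H^T + N R\right)^{-1}, \qquad P^{(i)} = \left(I - K^{(i)}H\right)P^{(i-1)}.$$ Then the $N$th iterative covariance update is exactly equal to the Kalman covariance update, i.e. $P^{(N)} = \hat P$, where $$\hat P = (I - KH)\bar P, \qquad K = \bar P H^T\left(H\bar P H^T + R\right)^{-1}.$$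
   Context: All matrices are real and $I$ denotes the $n\times n$ identity matrix. A covariance matrix is a symmetric positive semidefinite matrix. The matrix $K$ is the usual Kalman gain of a single Kalman update with prior covariance $\bar P$, measurement matrix $H$ and measurement noise covariance $R$. The recursion defining $P^{(i)}$ performs $N$ successive Kalman covariance updates with inflated measurement noise covariance $NR$. *)

theory Defs
  imports "HOL-Analysis.Analysis"
begin

definition symmetric_matrix :: "real^'n^'n \<Rightarrow> bool" where
  "symmetric_matrix A \<longleftrightarrow> transpose A = A"

definition positive_semidefinite :: "real^'n^'n \<Rightarrow> bool" where
  "positive_semidefinite A \<longleftrightarrow> (\<forall>x. 0 \<le> x \<bullet> (A *v x))"

definition positive_definite :: "real^'n^'n \<Rightarrow> bool" where
  "positive_definite A \<longleftrightarrow> (\<forall>x. x \<noteq> 0 \<longrightarrow> 0 < x \<bullet> (A *v x))"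

definition covariance_matrix :: "real^'n^'n \<Rightarrow> bool" where
  "covariance_matrix A \<longleftrightarrow> symmetric_matrix A \<and> positive_semidefinite A"

text \<open>The gain applies the total function \<^const>\<open>matrix_inv\<close>, which is unspecified on singular
  matrices. If \<open>P\<close> is positive semidefinite and \<open>S\<close> is positive definite, the innovation
  covariance inverted here is positive definite, so this is the genuine inverse.\<close>

definition kalman_gain :: "real^'n^'m \<Rightarrow> real^'m^'m \<Rightarrow> real^'n^'n \<Rightarrow> real^'m^'n" where
  "kalman_gain H S P = P ** transpose H ** matrix_inv (H ** P ** transpose H + S)"

end

theory Submission
  imports Defs
begin

text \<open>With \<open>G = H P H\<^sup>T\<close> and \<open>S = N R\<close>, the \<open>i\<close>th covariance has the closed form
  \<open>P - i P H\<^sup>T (i G + S)\<^sup>-\<^sup>1 H P\<close>. The induction step is the identity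
  \<open>(i + 1) B\<^sup>-\<^sup>1 = i A\<^sup>-\<^sup>1 + B\<^sup>-\<^sup>1 S A\<^sup>-\<^sup>1\<close> for \<open>A = i G + S\<close> and \<open>B = (i + 1) G + S\<close>. For \<open>i = N\<close> the
  factor \<open>N\<close> cancels, leaving the single update with noise \<open>R\<close>.\<close>

lemma matrix_add_rdistrib: "(A + B) ** C = A ** C + B ** C"
  by (vector matrix_matrix_mult_def sum.distrib[symmetric] distrib_right)

lemma matrix_diff_ldistrib: "A ** (B - C) = A ** B - A ** C"
  for A :: "'a::ring_1^'n^'m"
  by (vector matrix_matrix_mult_def sum_subtractf[symmetric] right_diff_distrib)

lemma matrix_diff_rdistrib: "(A - B) ** C = A ** C - B ** C"
  for A :: "'a::ring_1^'n^'m"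
  by (vector matrix_matrix_mult_def sum_subtractf[symmetric] left_diff_distrib)

lemma matrix_inv_inverse:
  assumes "invertible A"
  shows matrix_inv_right: "A ** matrix_inv A = mat 1"
    and matrix_inv_left: "matrix_inv A ** A = mat 1"
  using someI_ex[OF assms[unfolded invertible_def]] by (simp_all add: matrix_inv_def)

text \<open>For square matrices over a field a right inverse is also a left inverse, so a single
  product check is enough to identify \<open>matrix_inv\<close>.\<close>

lemma matrix_inv_unique:
  fixes A B :: "'a::field^'n^'n"
  assumes "A ** B = mat 1"
  shows "matrix_inv A = B"
proof -
  have "B ** A = mat 1"
    using assms by (simp add: matrix_left_right_inverse)
  then have "invertible A"
    using assms by (auto simp: invertible_def)
  then have "matrix_inv A ** (A ** B) = B"
    by (simp add: matrix_mul_assoc matrix_inv_left)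
  then show ?thesis
    using assms by simp
qed

lemma positive_definite_imp_invertible:
  assumes "positive_definite A"
  shows "invertible A"
proof -
  have "x = 0" if "A *v x = 0" for x
    using assms that by (auto simp: positive_definite_def)
  then show ?thesis
    by (simp add: invertible_left_inverse matrix_left_invertible_ker)
qed

lemma positive_semidefinite_congruence:
  fixes H :: "real^'n^'m"
  assumes "positive_semidefinite P"
  shows "positive_semidefinite (H ** P ** transpose H)"
  unfolding positive_semidefinite_def
proof
  fix x :: "real^'m"
  have "x \<bullet> ((H ** P ** transpose H) *v x) = (transpose H *v x) \<bullet> (P *v (transpose H *v x))"
    by (simp flip: matrix_vector_mul_assoc dot_lmul_matrix)
  then show "0 \<le> x \<bullet> ((H ** P ** transpose H) *v x)"
    using assms by (simp add: positive_semidefinite_def)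
qed

text \<open>Source of every invertibility fact about \<open>t *\<^sub>R G + S\<close> and, with
  \<open>t = 1\<close>, about \<open>G + R\<close>.\<close>

lemma positive_definite_scaleR_add:
  assumes "positive_semidefinite A" "positive_definite B" "t \<ge> 0"
  shows "positive_definite (t *\<^sub>R A + B)"
  using assms
  by (auto simp: positive_definite_def positive_semidefinite_def inner_add_right
      matrix_vector_mult_add_rdistrib add_nonneg_pos simp flip: scaleR_matrix_vector_assoc)

lemma positive_definite_scaleR:
  assumes "positive_definite A" "t > 0"
  shows "positive_definite (t *\<^sub>R A)"
  using assms by (auto simp: positive_definite_def simp flip: scaleR_matrix_vector_assoc)

lemma matrix_inv_scaleR:
  fixes A :: "real^'n^'n"
  assumes "invertible A" "t \<noteq> 0"
  shows "matrix_inv (t *\<^sub>R A) = inverse t *\<^sub>R matrix_inv A"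
  using assms
  by (intro matrix_inv_unique) (simp add: matrix_scalar_ac matrix_inv_right flip: scalar_matrix_assoc)

lemma kalman_update_eq:
  "(mat 1 - kalman_gain H S P ** H) ** P =
    P - P ** transpose H ** matrix_inv (H ** P ** transpose H + S) ** H ** P"
  by (simp add: kalman_gain_def matrix_diff_rdistrib)

text \<open>\<open>Q\<close> is the closed form with a real parameter in place of the step count.
  The update works because the innovation covariance at \<open>Q t\<close> factors through
  \<open>A\<close> and \<open>B\<close>, so its inverse is explicit.\<close>

lemma kalman_update_step:
  fixes P :: "real^'n^'n" and H :: "real^'n^'m" and S :: "real^'m^'m" and t :: real
  defines "G \<equiv> H ** P ** transpose H"
  defines "Q \<equiv> \<lambda>s. P - s *\<^sub>R (P ** transpose H ** matrix_inv (s *\<^sub>R G + S) ** H ** P)"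
  assumes "invertible S" "invertible (t *\<^sub>R G + S)" "invertible ((t + 1) *\<^sub>R G + S)"
  shows "(mat 1 - kalman_gain H S (Q t) ** H) ** Q t = Q (t + 1)"
proof -
  define A where "A = t *\<^sub>R G + S"
  define B where "B = (t + 1) *\<^sub>R G + S"
  define A' where "A' = matrix_inv A"
  define B' where "B' = matrix_inv B"
  define S' where "S' = matrix_inv S"
  have inv: "A ** A' = mat 1" "A' ** A = mat 1" "B ** B' = mat 1" "B' ** B = mat 1"
    "S ** S' = mat 1" "S' ** S = mat 1"
    using assms by (simp_all add: A_def A'_def B_def B'_def S'_def matrix_inv_left matrix_inv_right)
  \<comment> \<open>\<open>matrix_mul_assoc\<close> nests products to the left, so an inverse pair
    inside a longer product appears behind a prefix \<open>X\<close>.\<close>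
  have cancel: "X ** A ** A' = X" "X ** A' ** A = X" "X ** B ** B' = X" "X ** B' ** B = X"
    "X ** S ** S' = X" "X ** S' ** S = X" for X :: "real^'m^'k"
    using inv by (simp_all flip: matrix_mul_assoc)
  have tG: "t *\<^sub>R G = A - S"
    by (simp add: A_def)
  have B: "B = G + A"
    by (simp add: A_def B_def algebra_simps)
  have Q: "Q t = P - t *\<^sub>R (P ** transpose H ** A' ** H ** P)"
    by (simp add: Q_def A_def A'_def)
  \<comment> \<open>Since \<open>t *\<^sub>R G = A - S\<close>, the factor
    \<open>mat 1 - (t *\<^sub>R G) ** A'\<close> collapses to \<open>S ** A'\<close>;
    \<open>right\<close> is the mirror image.\<close>
  have left: "H ** Q t = S ** A' ** H ** P"
  proof -
    have "H ** Q t = (mat 1 - (t *\<^sub>R G) ** A') ** H ** P"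
      by (simp add: Q G_def matrix_diff_ldistrib matrix_diff_rdistrib matrix_scalar_ac
          matrix_mul_assoc flip: scalar_matrix_assoc)
    then show ?thesis
      by (simp add: tG matrix_diff_rdistrib inv)
  qed
  have right: "Q t ** transpose H = P ** transpose H ** A' ** S"
  proof -
    have "Q t ** transpose H = P ** transpose H ** (mat 1 - A' ** (t *\<^sub>R G))"
      by (simp add: Q G_def matrix_diff_ldistrib matrix_diff_rdistrib matrix_scalar_ac
          matrix_mul_assoc flip: scalar_matrix_assoc)
    then show ?thesis
      by (simp add: tG matrix_diff_ldistrib inv matrix_mul_assoc)
  qed
  have "H ** Q t ** transpose H + S = G ** A' ** S + S"
    using right by (simp add: G_def flip: matrix_mul_assoc)
  \<comment> \<open>Writing the last summand as \<open>A ** A' ** S\<close> gives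
    \<open>(G + A) ** A' ** S\<close>. The inverse is then read off factor by factor.\<close>
  also have "\<dots> = B ** A' ** S"
    by (simp add: B matrix_add_rdistrib inv)
  finally have "matrix_inv (H ** Q t ** transpose H + S) = S' ** A ** B'"
    by (intro matrix_inv_unique) (simp add: matrix_mul_assoc cancel inv)
  then have "(mat 1 - kalman_gain H S (Q t) ** H) ** Q t =
      Q t - (Q t ** transpose H) ** (S' ** A ** B') ** (H ** Q t)"
    by (simp add: kalman_update_eq matrix_mul_assoc)
  \<comment> \<open>The outer factors contribute \<open>A' ** S\<close> and \<open>S ** A'\<close>;
    the first cancels against \<open>S' ** A\<close>.\<close>
  also have "\<dots> = Q t - P ** transpose H ** (B' ** S ** A') ** H ** P"
    unfolding left right by (simp add: matrix_mul_assoc cancel)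
  also have "B' ** S ** A' = (t + 1) *\<^sub>R B' - t *\<^sub>R A'"
  proof -
    \<comment> \<open>This combination eliminates \<open>G\<close>: both terms contain it with
      coefficient \<open>t * (t + 1)\<close>.\<close>
    have "S = (t + 1) *\<^sub>R A - t *\<^sub>R B"
      by (simp add: A_def B_def algebra_simps)
    then have "B' ** S ** A' = B' ** ((t + 1) *\<^sub>R A - t *\<^sub>R B) ** A'"
      by simp
    also have "\<dots> = (t + 1) *\<^sub>R (B' ** A ** A') - t *\<^sub>R (B' ** B ** A')"
      by (simp only: matrix_diff_ldistrib matrix_diff_rdistrib matrix_scalar_ac
          scalar_matrix_assoc[symmetric])
    finally show ?thesis
      by (simp add: cancel inv)
  qed
  also have "P ** transpose H ** \<dots> ** H ** P =
      (t + 1) *\<^sub>R (P ** transpose H ** B' ** H ** P) - t *\<^sub>R (P ** transpose H ** A' ** H ** P)"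
    by (simp only: matrix_diff_ldistrib matrix_diff_rdistrib matrix_scalar_ac
        scalar_matrix_assoc[symmetric])
  \<comment> \<open>The term with \<open>A'\<close> cancels the correction inside
    \<open>Q t\<close>, leaving only the one with \<open>B'\<close>.\<close>
  finally show ?thesis
    by (simp add: Q_def A_def A'_def B_def B'_def)
qed

theorem theorem2p1:
  fixes Pbar Phat :: "real^'n^'n"
    and H :: "real^'n^'m"
    and R :: "real^'m^'m"
    and N :: nat
    and P :: "nat \<Rightarrow> real^'n^'n"
    and K :: "nat \<Rightarrow> real^'m^'n"
    and Kg :: "real^'m^'n"
  assumes "N \<ge> 1"
    and "covariance_matrix Pbar"
    and "symmetric_matrix R" and "positive_definite R"
    and "P 0 = Pbar"
    and "\<And>i. 1 \<le> i \<Longrightarrow> i \<le> N \<Longrightarrow> K i = kalman_gain H (real N *\<^sub>R R) (P (i - 1))"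
    and "\<And>i. 1 \<le> i \<Longrightarrow> i \<le> N \<Longrightarrow> P i = (mat 1 - K i ** H) ** P (i - 1)"
    and "Kg = kalman_gain H R Pbar"
    and "Phat = (mat 1 - Kg ** H) ** Pbar"
  shows "P N = Phat"
proof -
  define G where "G = H ** Pbar ** transpose H"
  define S where "S = real N *\<^sub>R R"
  have G: "positive_semidefinite G"
    using assms(2) by (simp add: G_def covariance_matrix_def positive_semidefinite_congruence)
  have S: "positive_definite S"
    using assms(1,4) by (simp add: S_def positive_definite_scaleR)
  have invertible: "invertible S" "\<And>t. t \<ge> 0 \<Longrightarrow> invertible (t *\<^sub>R G + S)"
    using G S by (auto intro: positive_definite_imp_invertible positive_definite_scaleR_add)
  have closed_form: "P i = Pbar - real i *\<^sub>R
      (Pbar ** transpose H ** matrix_inv (real i *\<^sub>R G + S) ** H ** Pbar)" if "i \<le> N" for i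
    using that
  proof (induction i)
    case 0
    then show ?case
      using assms(5) by simp
  next
    case (Suc i)
    then have "P (Suc i) = (mat 1 - kalman_gain H S (P i) ** H) ** P i"
      using assms(6,7)[of "Suc i"] by (simp add: S_def)
    \<comment> \<open>By the induction hypothesis \<open>P i\<close> is \<open>Q (real i)\<close> in
      the notation of \<open>kalman_update_step\<close>.\<close>
    also have "\<dots> = Pbar - (real i + 1) *\<^sub>R
        (Pbar ** transpose H ** matrix_inv ((real i + 1) *\<^sub>R G + S) ** H ** Pbar)"
      using Suc kalman_update_step[of S "real i" H Pbar] invertible by (simp add: G_def)
    finally show ?case
      by (simp add: add.commute)
  qed
  have GR: "invertible (G + R)"
    using positive_definite_scaleR_add[OF G assms(4), of 1]
    by (simp add: positive_definite_imp_invertible)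
  \<comment> \<open>The inflation of the noise by \<open>N\<close> makes \<open>N\<close> a common
    factor; its reciprocal in the inverse offsets the \<open>N\<close> in
    \<open>closed_form\<close>.\<close>
  have "real N *\<^sub>R G + S = real N *\<^sub>R (G + R)"
    by (simp add: S_def scaleR_add_right)
  then have "matrix_inv (real N *\<^sub>R G + S) = inverse (real N) *\<^sub>R matrix_inv (G + R)"
    using assms(1) GR by (simp add: matrix_inv_scaleR)
  then have "P N = Pbar - Pbar ** transpose H ** matrix_inv (G + R) ** H ** Pbar"
    using closed_form[of N] assms(1)
    by (simp add: matrix_scalar_ac flip: scalar_matrix_assoc)
  then show ?thesis
    using assms(8,9) by (simp add: kalman_update_eq G_def)
qed

end
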